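(* Every Kleene monad $(T,\mu,\eta)$ on a category $\mathsf{C}$ is an ordered saturation monad (with respect to the order on hom-sets of $\mathcal{K}l(T)$ induced by the join-semilattice structure) which moreover satisfies, for all $\alpha:X\rightsquigarrow X$, all $f:X\rightsquigarrow Y$ in $\mathcal{K}l(T)$ and all $\beta:Y\rightsquigarrow Y$: $f\cdot\alpha\le\beta\cdot f$ implies $f\cdot\alpha^*\le\beta^*\cdot f$, and $f\cdot\alpha\ge\beta\cdot f$ implies $f\cdot\alpha^*\ge\beta^*\cdot f$.
   Context: Kleisli category $\mathcal{K}l(T)$: morphisms $X\rightsquigarrow Y$ are morphisms $X\to TY$, composition $g\cdot f=\mu_Z\circ Tg\circ f$, identity $1_X=\eta_X$; $f^\sharp=\eta_Y\circ f$. A monad is additive if every hom-set of $\mathcal{K}l(T)$ is a join-semilattice $(\vee)$ with least element $\bot$ such that $(f\vee g)\cdot h=f\cdot h\vee g\cdot h$, $h\cdot(f\vee g)=h\cdot f\vee h\cdot g$ and $f\cdot\bot=\bot\cdot f=\bot$. It is a Kleene monad if additionally, for all composable $p,r$, the maps $f\mapsto p\vee f\cdot r$ and $f\mapsto p\vee r\cdot f$ have least fixed points (denoted $\mu x.(\dots)$), and for all suitable $q$: $\mu x.(p\cdot q\vee x\cdot r)=p\cdot\mu x.(q\vee x\cdot r)$ and $\mu x.(p\cdot q\vee r\cdot x)=\mu x.(p\vee r\cdot x)\cdot q$. Order: $f\le g$ iff $f\vee g=g$. Ordered saturation monad: $\mathcal{K}l(T)$ order enriched (hom-sets posets, composition monotone)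 and for each $\alpha:X\rightsquigarrow X$ there is $\alpha^*$ with (1) $1\le\alpha^*$; (2) $\alpha\le\alpha^*$; (3) $\alpha^*\cdot\alpha^*\le\alpha^*$; (4) $\alpha^*\le\beta$ whenever $1\le\beta$, $\alpha\le\beta$, $\beta\cdot\beta\le\beta$; (5) for $f:X\to Y$ in $\mathsf{C}$ and $\beta:Y\rightsquigarrow Y$, $f^\sharp\cdot\alpha\le\beta\cdot f^\sharp\Rightarrow f^\sharp\cdot\alpha^*\le\beta^*\cdot f^\sharp$, and likewise with $\ge$. *)

theory Defs
  imports Main
begin

text \<open>
  Composition is indexed by the three objects involved, and every operation on morphisms by its
  hom-set, because hom-sets are not required to be disjoint: when \<open>T Y = T Y'\<close>, the Kleisli
  hom-sets from \<open>X\<close> to \<open>Y\<close> and from \<open>X\<close> to \<open>Y'\<close> coincide as sets, but may carry different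
  structure.  \<open>Cmp C X Y Z g f\<close> is \<open>g \<circ> f\<close> for \<open>f : X \<rightarrow> Y\<close> and \<open>g : Y \<rightarrow> Z\<close>.
\<close>

record ('o, 'a) cat =
  Obj :: "'o set"
  Hom :: "'o \<Rightarrow> 'o \<Rightarrow> 'a set"
  Cmp :: "'o \<Rightarrow> 'o \<Rightarrow> 'o \<Rightarrow> 'a \<Rightarrow> 'a \<Rightarrow> 'a"
  Idt :: "'o \<Rightarrow> 'a"

locale category =
  fixes C :: "('o, 'a) cat"
  assumes Idt_in: "X \<in> Obj C \<Longrightarrow> Idt C X \<in> Hom C X X"
    and Cmp_in: "\<lbrakk>X \<in> Obj C; Y \<in> Obj C; Z \<in> Obj C; f \<in> Hom C X Y; g \<in> Hom C Y Z\<rbrakk>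
      \<Longrightarrow> Cmp C X Y Z g f \<in> Hom C X Z"
    and Idt_left: "\<lbrakk>X \<in> Obj C; Y \<in> Obj C; f \<in> Hom C X Y\<rbrakk> \<Longrightarrow> Cmp C X Y Y (Idt C Y) f = f"
    and Idt_right: "\<lbrakk>X \<in> Obj C; Y \<in> Obj C; f \<in> Hom C X Y\<rbrakk> \<Longrightarrow> Cmp C X X Y f (Idt C X) = f"
    and Cmp_assoc: "\<lbrakk>W \<in> Obj C; X \<in> Obj C; Y \<in> Obj C; Z \<in> Obj C;
        f \<in> Hom C W X; g \<in> Hom C X Y; h \<in> Hom C Y Z\<rbrakk>
      \<Longrightarrow> Cmp C W X Z (Cmp C X Y Z h g) f = Cmp C W Y Z h (Cmp C W X Y g f)"

record ('o, 'a) monad_data =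
  T_ob :: "'o \<Rightarrow> 'o"
  T_mor :: "'o \<Rightarrow> 'o \<Rightarrow> 'a \<Rightarrow> 'a"
  unit :: "'o \<Rightarrow> 'a"
  mult :: "'o \<Rightarrow> 'a"

locale endofunctor = category C
  for C :: "('o, 'a) cat" +
  fixes F :: "'o \<Rightarrow> 'o" and Fm :: "'o \<Rightarrow> 'o \<Rightarrow> 'a \<Rightarrow> 'a"
  assumes F_ob_in: "X \<in> Obj C \<Longrightarrow> F X \<in> Obj C"
    and F_mor_in: "\<lbrakk>X \<in> Obj C; Y \<in> Obj C; f \<in> Hom C X Y\<rbrakk> \<Longrightarrow> Fm X Y f \<in> Hom C (F X) (F Y)"
    and F_Idt: "X \<in> Obj C \<Longrightarrow> Fm X X (Idt C X) = Idt C (F X)"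
    and F_Cmp: "\<lbrakk>X \<in> Obj C; Y \<in> Obj C; Z \<in> Obj C; f \<in> Hom C X Y; g \<in> Hom C Y Z\<rbrakk>
      \<Longrightarrow> Fm X Z (Cmp C X Y Z g f) = Cmp C (F X) (F Y) (F Z) (Fm Y Z g) (Fm X Y f)"

locale monad = endofunctor C "T_ob M" "T_mor M"
  for C :: "('o, 'a) cat" and M :: "('o, 'a) monad_data" +
  assumes unit_in: "X \<in> Obj C \<Longrightarrow> unit M X \<in> Hom C X (T_ob M X)"
    and unit_natural: "\<lbrakk>X \<in> Obj C; Y \<in> Obj C; f \<in> Hom C X Y\<rbrakk> \<Longrightarrow>
      Cmp C X (T_ob M X) (T_ob M Y) (T_mor M X Y f) (unit M X) =
      Cmp C X Y (T_ob M Y) (unit M Y) f"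
    and mult_in: "X \<in> Obj C \<Longrightarrow> mult M X \<in> Hom C (T_ob M (T_ob M X)) (T_ob M X)"
    and mult_natural: "\<lbrakk>X \<in> Obj C; Y \<in> Obj C; f \<in> Hom C X Y\<rbrakk> \<Longrightarrow>
      Cmp C (T_ob M (T_ob M X)) (T_ob M X) (T_ob M Y) (T_mor M X Y f) (mult M X) =
      Cmp C (T_ob M (T_ob M X)) (T_ob M (T_ob M Y)) (T_ob M Y) (mult M Y)
        (T_mor M (T_ob M X) (T_ob M Y) (T_mor M X Y f))"
    and mult_unit: "X \<in> Obj C \<Longrightarrow>
      Cmp C (T_ob M X) (T_ob M (T_ob M X)) (T_ob M X) (mult M X) (unit M (T_ob M X)) =
      Idt C (T_ob M X)"
    and mult_T_unit: "X \<in> Obj C \<Longrightarrow>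
      Cmp C (T_ob M X) (T_ob M (T_ob M X)) (T_ob M X) (mult M X)
        (T_mor M X (T_ob M X) (unit M X)) =
      Idt C (T_ob M X)"
    and mult_assoc: "X \<in> Obj C \<Longrightarrow>
      Cmp C (T_ob M (T_ob M (T_ob M X))) (T_ob M (T_ob M X)) (T_ob M X) (mult M X)
        (mult M (T_ob M X)) =
      Cmp C (T_ob M (T_ob M (T_ob M X))) (T_ob M (T_ob M X)) (T_ob M X) (mult M X)
        (T_mor M (T_ob M (T_ob M X)) (T_ob M X) (mult M X))"

definition kleisli :: "('o, 'a) cat \<Rightarrow> ('o, 'a) monad_data \<Rightarrow> ('o, 'a) cat" where
  "kleisli C M =
    \<lparr>Obj = Obj C,
     Hom = (\<lambda>X Y. Hom C X (T_ob M Y)),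
     Cmp = (\<lambda>X Y Z g f.
       Cmp C X (T_ob M (T_ob M Z)) (T_ob M Z) (mult M Z)
         (Cmp C X (T_ob M Y) (T_ob M (T_ob M Z)) (T_mor M Y (T_ob M Z) g) f)),
     Idt = unit M\<rparr>"

lemma (in monad) category_kleisli: "category (kleisli C M)"
proof
  fix X assume "X \<in> Obj (kleisli C M)"
  then show "Idt (kleisli C M) X \<in> Hom (kleisli C M) X X"
    by (simp add: kleisli_def unit_in)
next
  fix X Y Z f g
  assume "X \<in> Obj (kleisli C M)" "Y \<in> Obj (kleisli C M)" "Z \<in> Obj (kleisli C M)"
    "f \<in> Hom (kleisli C M) X Y" "g \<in> Hom (kleisli C M) Y Z"
  then show "Cmp (kleisli C M) X Y Z g f \<in> Hom (kleisli C M) X Z"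
    unfolding kleisli_def by simp (meson Cmp_in F_mor_in F_ob_in mult_in)
next
  fix X Y f
  assume "X \<in> Obj (kleisli C M)" "Y \<in> Obj (kleisli C M)" "f \<in> Hom (kleisli C M) X Y"
  then have XY: "X \<in> Obj C" "Y \<in> Obj C" "f \<in> Hom C X (T_ob M Y)"
    by (simp_all add: kleisli_def)
  show "Cmp (kleisli C M) X Y Y (Idt (kleisli C M) Y) f = f"
    using XY Cmp_assoc[of X "T_ob M Y" "T_ob M (T_ob M Y)" "T_ob M Y" f
        "T_mor M Y (T_ob M Y) (unit M Y)" "mult M Y"]
    by (simp add: kleisli_def F_ob_in F_mor_in unit_in mult_in mult_T_unit Idt_left)
  show "Cmp (kleisli C M) X X Y f (Idt (kleisli C M) X) = f"
    using XY Cmp_assoc[of X "T_ob M Y" "T_ob M (T_ob M Y)" "T_ob M Y" f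
        "unit M (T_ob M Y)" "mult M Y"]
    by (simp add: kleisli_def F_ob_in F_mor_in unit_in mult_in mult_unit Idt_left unit_natural)
next
  fix W X Y Z f g h
  assume "W \<in> Obj (kleisli C M)" "X \<in> Obj (kleisli C M)" "Y \<in> Obj (kleisli C M)"
    "Z \<in> Obj (kleisli C M)" "f \<in> Hom (kleisli C M) W X" "g \<in> Hom (kleisli C M) X Y"
    "h \<in> Hom (kleisli C M) Y Z"
  then have a: "W \<in> Obj C" "X \<in> Obj C" "Y \<in> Obj C" "Z \<in> Obj C" "f \<in> Hom C W (T_ob M X)"
    "g \<in> Hom C X (T_ob M Y)" "h \<in> Hom C Y (T_ob M Z)"
    by (simp_all add: kleisli_def)
  let ?T = "T_ob M"
  note obs = a F_ob_in F_mor_in mult_in Cmp_in[of _ "?T Y"] Cmp_in[of _ "?T (?T Z)"]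
    Cmp_in[of _ "?T X"] Cmp_in[of _ "?T (?T Y)"] Cmp_in[of _ "?T (?T (?T Z))"]
  let ?Th = "T_mor M Y (?T Z) h" and ?Tg = "T_mor M X (?T Y) g"
  let ?TTh = "T_mor M (?T Y) (?T (?T Z)) ?Th" and ?Tm = "T_mor M (?T (?T Z)) (?T Z) (mult M Z)"
  let ?u = "Cmp C W (?T X) (?T (?T Y)) ?Tg f"
  have u: "?u \<in> Hom C W (?T (?T Y))" by (simp add: obs)
  have "Cmp (kleisli C M) W X Z (Cmp (kleisli C M) X Y Z h g) f =
    Cmp C W (?T (?T Z)) (?T Z) (mult M Z)
      (Cmp C W (?T (?T (?T Z))) (?T (?T Z)) ?Tm (Cmp C W (?T (?T Y)) (?T (?T (?T Z))) ?TTh ?u))"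
    by (simp add: kleisli_def obs F_Cmp[of _ "?T (?T Z)"] F_Cmp[of _ "?T Y"]
        Cmp_assoc[of W "?T X"])
  also have "\<dots> = Cmp C W (?T (?T Z)) (?T Z) (mult M Z)
      (Cmp C W (?T (?T (?T Z))) (?T (?T Z)) (mult M (?T Z))
        (Cmp C W (?T (?T Y)) (?T (?T (?T Z))) ?TTh ?u))"
    by (simp add: obs u mult_assoc
        flip: Cmp_assoc[of W "?T (?T (?T Z))" "?T (?T Z)" "?T Z" _ _ "mult M Z"])
  also have "Cmp C W (?T (?T (?T Z))) (?T (?T Z)) (mult M (?T Z))
        (Cmp C W (?T (?T Y)) (?T (?T (?T Z))) ?TTh ?u) =
      Cmp C W (?T Y) (?T (?T Z)) ?Th (Cmp C W (?T (?T Y)) (?T Y) (mult M Y) ?u)"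
    using mult_natural[of Y "?T Z" h]
    by (simp add: obs u flip: Cmp_assoc[of W "?T (?T Y)"])
  also have "Cmp C W (?T (?T Z)) (?T Z) (mult M Z) \<dots> =
      Cmp (kleisli C M) W Y Z h (Cmp (kleisli C M) W X Y g f)"
    by (simp add: kleisli_def)
  finally show "Cmp (kleisli C M) W X Z (Cmp (kleisli C M) X Y Z h g) f =
      Cmp (kleisli C M) W Y Z h (Cmp (kleisli C M) W X Y g f)" .
qed

definition sharp :: "('o, 'a) cat \<Rightarrow> ('o, 'a) monad_data \<Rightarrow> 'o \<Rightarrow> 'o \<Rightarrow> 'a \<Rightarrow> 'a" where
  "sharp C M X Y f = Cmp C X Y (T_ob M Y) (unit M Y) f"

locale additive_monad = monad C M
  for C :: "('o, 'a) cat" and M :: "('o, 'a) monad_data" +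
  fixes J :: "'o \<Rightarrow> 'o \<Rightarrow> 'a \<Rightarrow> 'a \<Rightarrow> 'a" and B :: "'o \<Rightarrow> 'o \<Rightarrow> 'a"
  assumes J_in: "\<lbrakk>X \<in> Obj C; Y \<in> Obj C; f \<in> Hom (kleisli C M) X Y; g \<in> Hom (kleisli C M) X Y\<rbrakk>
      \<Longrightarrow> J X Y f g \<in> Hom (kleisli C M) X Y"
    and J_assoc: "\<lbrakk>X \<in> Obj C; Y \<in> Obj C; f \<in> Hom (kleisli C M) X Y;
        g \<in> Hom (kleisli C M) X Y; h \<in> Hom (kleisli C M) X Y\<rbrakk>
      \<Longrightarrow> J X Y (J X Y f g) h = J X Y f (J X Y g h)"
    and J_commute: "\<lbrakk>X \<in> Obj C; Y \<in> Obj C; f \<in> Hom (kleisli C M) X Y;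
        g \<in> Hom (kleisli C M) X Y\<rbrakk>
      \<Longrightarrow> J X Y f g = J X Y g f"
    and J_idem: "\<lbrakk>X \<in> Obj C; Y \<in> Obj C; f \<in> Hom (kleisli C M) X Y\<rbrakk> \<Longrightarrow> J X Y f f = f"
    and B_in: "\<lbrakk>X \<in> Obj C; Y \<in> Obj C\<rbrakk> \<Longrightarrow> B X Y \<in> Hom (kleisli C M) X Y"
    and B_least: "\<lbrakk>X \<in> Obj C; Y \<in> Obj C; f \<in> Hom (kleisli C M) X Y\<rbrakk> \<Longrightarrow> J X Y (B X Y) f = f"
    and J_Cmp: "\<lbrakk>X \<in> Obj C; Y \<in> Obj C; Z \<in> Obj C; h \<in> Hom (kleisli C M) X Y;
        f \<in> Hom (kleisli C M) Y Z; g \<in> Hom (kleisli C M) Y Z\<rbrakk>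
      \<Longrightarrow> Cmp (kleisli C M) X Y Z (J Y Z f g) h =
          J X Z (Cmp (kleisli C M) X Y Z f h) (Cmp (kleisli C M) X Y Z g h)"
    and Cmp_J: "\<lbrakk>X \<in> Obj C; Y \<in> Obj C; Z \<in> Obj C; f \<in> Hom (kleisli C M) X Y;
        g \<in> Hom (kleisli C M) X Y; h \<in> Hom (kleisli C M) Y Z\<rbrakk>
      \<Longrightarrow> Cmp (kleisli C M) X Y Z h (J X Y f g) =
          J X Z (Cmp (kleisli C M) X Y Z h f) (Cmp (kleisli C M) X Y Z h g)"
    and Cmp_B: "\<lbrakk>X \<in> Obj C; Y \<in> Obj C; Z \<in> Obj C; f \<in> Hom (kleisli C M) Y Z\<rbrakk>
      \<Longrightarrow> Cmp (kleisli C M) X Y Z f (B X Y) = B X Z"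
    and B_Cmp: "\<lbrakk>X \<in> Obj C; Y \<in> Obj C; Z \<in> Obj C; f \<in> Hom (kleisli C M) X Y\<rbrakk>
      \<Longrightarrow> Cmp (kleisli C M) X Y Z (B Y Z) f = B X Z"

definition join_le :: "('o \<Rightarrow> 'o \<Rightarrow> 'a \<Rightarrow> 'a \<Rightarrow> 'a) \<Rightarrow> 'o \<Rightarrow> 'o \<Rightarrow> 'a \<Rightarrow> 'a \<Rightarrow> bool" where
  "join_le J X Y f g \<longleftrightarrow> J X Y f g = g"

definition is_least_fixpoint ::
  "'a set \<Rightarrow> ('a \<Rightarrow> 'a \<Rightarrow> bool) \<Rightarrow> ('a \<Rightarrow> 'a) \<Rightarrow> 'a \<Rightarrow> bool" where
  "is_least_fixpoint A le F h \<longleftrightarrow> h \<in> A \<and> F h = h \<and> (\<forall>g\<in>A. F g = g \<longrightarrow> le h g)"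

definition least_fixpoint :: "'a set \<Rightarrow> ('a \<Rightarrow> 'a \<Rightarrow> bool) \<Rightarrow> ('a \<Rightarrow> 'a) \<Rightarrow> 'a" where
  "least_fixpoint A le F = (THE h. is_least_fixpoint A le F h)"

locale kleene_monad = additive_monad C M J B
  for C :: "('o, 'a) cat" and M :: "('o, 'a) monad_data"
    and J :: "'o \<Rightarrow> 'o \<Rightarrow> 'a \<Rightarrow> 'a \<Rightarrow> 'a" and B :: "'o \<Rightarrow> 'o \<Rightarrow> 'a" +
  assumes ex_lfp_right: "\<lbrakk>X \<in> Obj C; Y \<in> Obj C; p \<in> Hom (kleisli C M) X Y;
        r \<in> Hom (kleisli C M) X X\<rbrakk>
      \<Longrightarrow> \<exists>h. is_least_fixpoint (Hom (kleisli C M) X Y) (join_le J X Y)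
            (\<lambda>x. J X Y p (Cmp (kleisli C M) X X Y x r)) h"
    and ex_lfp_left: "\<lbrakk>X \<in> Obj C; Y \<in> Obj C; p \<in> Hom (kleisli C M) X Y;
        r \<in> Hom (kleisli C M) Y Y\<rbrakk>
      \<Longrightarrow> \<exists>h. is_least_fixpoint (Hom (kleisli C M) X Y) (join_le J X Y)
            (\<lambda>x. J X Y p (Cmp (kleisli C M) X Y Y r x)) h"
    and lfp_right: "\<lbrakk>X \<in> Obj C; Y \<in> Obj C; Z \<in> Obj C; q \<in> Hom (kleisli C M) X Y;
        p \<in> Hom (kleisli C M) Y Z; r \<in> Hom (kleisli C M) X X\<rbrakk>
      \<Longrightarrow> least_fixpoint (Hom (kleisli C M) X Z) (join_le J X Z)
            (\<lambda>x. J X Z (Cmp (kleisli C M) X Y Z p q) (Cmp (kleisli C M) X X Z x r)) =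
          Cmp (kleisli C M) X Y Z p
            (least_fixpoint (Hom (kleisli C M) X Y) (join_le J X Y)
              (\<lambda>x. J X Y q (Cmp (kleisli C M) X X Y x r)))"
    and lfp_left: "\<lbrakk>X \<in> Obj C; Y \<in> Obj C; Z \<in> Obj C; q \<in> Hom (kleisli C M) X Y;
        p \<in> Hom (kleisli C M) Y Z; r \<in> Hom (kleisli C M) Z Z\<rbrakk>
      \<Longrightarrow> least_fixpoint (Hom (kleisli C M) X Z) (join_le J X Z)
            (\<lambda>x. J X Z (Cmp (kleisli C M) X Y Z p q) (Cmp (kleisli C M) X Z Z r x)) =
          Cmp (kleisli C M) X Y Z
            (least_fixpoint (Hom (kleisli C M) Y Z) (join_le J Y Z)
              (\<lambda>x. J Y Z p (Cmp (kleisli C M) Y Z Z r x))) q"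

locale order_enriched = category C
  for C :: "('o, 'a) cat" +
  fixes le :: "'o \<Rightarrow> 'o \<Rightarrow> 'a \<Rightarrow> 'a \<Rightarrow> bool"
  assumes le_refl: "\<lbrakk>X \<in> Obj C; Y \<in> Obj C; f \<in> Hom C X Y\<rbrakk> \<Longrightarrow> le X Y f f"
    and le_antisym: "\<lbrakk>X \<in> Obj C; Y \<in> Obj C; f \<in> Hom C X Y; g \<in> Hom C X Y;
        le X Y f g; le X Y g f\<rbrakk> \<Longrightarrow> f = g"
    and le_trans: "\<lbrakk>X \<in> Obj C; Y \<in> Obj C; f \<in> Hom C X Y; g \<in> Hom C X Y; h \<in> Hom C X Y;
        le X Y f g; le X Y g h\<rbrakk> \<Longrightarrow> le X Y f h"
    and Cmp_mono: "\<lbrakk>X \<in> Obj C; Y \<in> Obj C; Z \<in> Obj C; f \<in> Hom C X Y; f' \<in> Hom C X Y;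
        g \<in> Hom C Y Z; g' \<in> Hom C Y Z; le X Y f f'; le Y Z g g'\<rbrakk>
      \<Longrightarrow> le X Z (Cmp C X Y Z g f) (Cmp C X Y Z g' f')"

text \<open>
  The first four conditions on \<open>star\<close> determine \<open>star X \<alpha>\<close> uniquely for every Kleisli endomorphism
  \<open>\<alpha>\<close> of \<open>X\<close>, so making \<open>star\<close> a parameter of the locale involves no choice.
\<close>

locale ordered_saturation_monad = monad C M + order_enriched "kleisli C M" le
  for C :: "('o, 'a) cat" and M :: "('o, 'a) monad_data"
    and le :: "'o \<Rightarrow> 'o \<Rightarrow> 'a \<Rightarrow> 'a \<Rightarrow> bool" +
  fixes star :: "'o \<Rightarrow> 'a \<Rightarrow> 'a"
  assumes star_in: "\<lbrakk>X \<in> Obj C; \<alpha> \<in> Hom (kleisli C M) X X\<rbrakk>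
      \<Longrightarrow> star X \<alpha> \<in> Hom (kleisli C M) X X"
    and star_refl: "\<lbrakk>X \<in> Obj C; \<alpha> \<in> Hom (kleisli C M) X X\<rbrakk>
      \<Longrightarrow> le X X (Idt (kleisli C M) X) (star X \<alpha>)"
    and star_incl: "\<lbrakk>X \<in> Obj C; \<alpha> \<in> Hom (kleisli C M) X X\<rbrakk> \<Longrightarrow> le X X \<alpha> (star X \<alpha>)"
    and star_trans: "\<lbrakk>X \<in> Obj C; \<alpha> \<in> Hom (kleisli C M) X X\<rbrakk>
      \<Longrightarrow> le X X (Cmp (kleisli C M) X X X (star X \<alpha>) (star X \<alpha>)) (star X \<alpha>)"
    and star_least: "\<lbrakk>X \<in> Obj C; \<alpha> \<in> Hom (kleisli C M) X X; \<beta> \<in> Hom (kleisli C M) X X;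
        le X X (Idt (kleisli C M) X) \<beta>; le X X \<alpha> \<beta>;
        le X X (Cmp (kleisli C M) X X X \<beta> \<beta>) \<beta>\<rbrakk>
      \<Longrightarrow> le X X (star X \<alpha>) \<beta>"
    and star_sharp_le: "\<lbrakk>X \<in> Obj C; Y \<in> Obj C; \<alpha> \<in> Hom (kleisli C M) X X; f \<in> Hom C X Y;
        \<beta> \<in> Hom (kleisli C M) Y Y;
        le X Y (Cmp (kleisli C M) X X Y (sharp C M X Y f) \<alpha>)
               (Cmp (kleisli C M) X Y Y \<beta> (sharp C M X Y f))\<rbrakk>
      \<Longrightarrow> le X Y (Cmp (kleisli C M) X X Y (sharp C M X Y f) (star X \<alpha>))
                 (Cmp (kleisli C M) X Y Y (star Y \<beta>) (sharp C M X Y f))"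
    and star_sharp_ge: "\<lbrakk>X \<in> Obj C; Y \<in> Obj C; \<alpha> \<in> Hom (kleisli C M) X X; f \<in> Hom C X Y;
        \<beta> \<in> Hom (kleisli C M) Y Y;
        le X Y (Cmp (kleisli C M) X Y Y \<beta> (sharp C M X Y f))
               (Cmp (kleisli C M) X X Y (sharp C M X Y f) \<alpha>)\<rbrakk>
      \<Longrightarrow> le X Y (Cmp (kleisli C M) X Y Y (star Y \<beta>) (sharp C M X Y f))
                 (Cmp (kleisli C M) X X Y (sharp C M X Y f) (star X \<alpha>))"

end

theory Submission
  imports Defs
begin

text \<open>
  By the two exchange laws, \<open>\<mu>x. (p \<or> x \<cdot> r) = p \<cdot> r\<^sub>R\<close> and \<open>\<mu>x. (p \<or> r \<cdot> x) = r\<^sub>L \<cdot> p\<close>, where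
  \<open>r\<^sub>R = \<mu>x. (1 \<or> x \<cdot> r)\<close> and \<open>r\<^sub>L = \<mu>x. (1 \<or> r \<cdot> x)\<close>; in particular both fixed points are monotone
  in \<open>p\<close>.  This upgrades least fixed points to least prefixed points: if \<open>p \<or> r \<cdot> g \<le> g\<close>, then \<open>g\<close>
  is a fixed point of \<open>x \<mapsto> g \<or> r \<cdot> x\<close>, so \<open>r\<^sub>L \<cdot> p \<le> r\<^sub>L \<cdot> g \<le> g\<close>.  The resulting two induction
  principles give \<open>r\<^sub>L = r\<^sub>R\<close> and all conditions on the saturation \<open>r\<^sup>* = r\<^sub>R\<close>.
\<close>

section \<open>Order enrichment of the Kleisli category\<close>

lemma (in additive_monad) order_enriched_kleisli: "order_enriched (kleisli C M) (join_le J)"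
proof -
  interpret K: category "kleisli C M" by (rule category_kleisli)
  have ob: "Obj (kleisli C M) = Obj C" by (simp add: kleisli_def)
  show ?thesis
  proof (unfold_locales, unfold ob join_le_def)
    fix X Y f assume "X \<in> Obj C" "Y \<in> Obj C" "f \<in> Hom (kleisli C M) X Y"
    then show "J X Y f f = f" by (rule J_idem)
  next
    fix X Y f g
    assume "X \<in> Obj C" "Y \<in> Obj C" "f \<in> Hom (kleisli C M) X Y" "g \<in> Hom (kleisli C M) X Y"
      "J X Y f g = g" "J X Y g f = f"
    then show "f = g" using J_commute by metis
  next
    fix X Y f g h
    assume "X \<in> Obj C" "Y \<in> Obj C" "f \<in> Hom (kleisli C M) X Y" "g \<in> Hom (kleisli C M) X Y"
      "h \<in> Hom (kleisli C M) X Y" "J X Y f g = g" "J X Y g h = h"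
    then show "J X Y f h = h" using J_assoc by metis
  next
    fix X Y Z f f' g g'
    assume XYZ: "X \<in> Obj C" "Y \<in> Obj C" "Z \<in> Obj C"
      and f: "f \<in> Hom (kleisli C M) X Y" "f' \<in> Hom (kleisli C M) X Y"
      and g: "g \<in> Hom (kleisli C M) Y Z" "g' \<in> Hom (kleisli C M) Y Z"
      and le: "J X Y f f' = f'" "J Y Z g g' = g'"
    let ?c = "Cmp (kleisli C M) X Y Z"
    have in_hom: "?c a b \<in> Hom (kleisli C M) X Z"
      if "a \<in> Hom (kleisli C M) Y Z" "b \<in> Hom (kleisli C M) X Y" for a b
      using that XYZ K.Cmp_in ob by simp
    \<comment> \<open>Distributivity over joins gives monotonicity in each argument separately;
      associativity of joins then chains the two inequalities through the intermediate composite
      \<open>?c g f'\<close>.\<close>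
    have "J X Z (?c g f) (?c g f') = ?c g f'"
      using Cmp_J[OF XYZ f g(1)] le by simp
    moreover have "J X Z (?c g f') (?c g' f') = ?c g' f'"
      using J_Cmp[OF XYZ f(2) g] le by simp
    ultimately show "J X Z (?c g f) (?c g' f') = ?c g' f'"
      using J_assoc[OF XYZ(1,3) in_hom[OF g(1) f(1)] in_hom[OF g(1) f(2)] in_hom[OF g(2) f(2)]]
      by simp
  qed
qed

context kleene_monad
begin

interpretation K: order_enriched "kleisli C M" "join_le J"
  by (rule order_enriched_kleisli)

lemma Obj_kleisli [simp]: "Obj (kleisli C M) = Obj C"
  by (simp add: kleisli_def)

lemmas kleisli_in = K.Idt_in[simplified] K.Cmp_in[simplified] J_in

abbreviation (input) kcmp where "kcmp X Y Z \<equiv> Cmp (kleisli C M) X Y Z"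
abbreviation (input) khom where "khom X Y \<equiv> Hom (kleisli C M) X Y"
abbreviation (input) kid where "kid X \<equiv> Idt (kleisli C M) X"
abbreviation (input) kle where "kle X Y \<equiv> join_le J X Y"

section \<open>Least fixed points and the two stars\<close>

lemma join_upper:
  assumes "X \<in> Obj C" "Y \<in> Obj C" "f \<in> khom X Y" "g \<in> khom X Y"
  shows "kle X Y f (J X Y f g)" and "kle X Y g (J X Y f g)"
  unfolding join_le_def using assms J_assoc J_idem J_commute J_in by metis+

text \<open>Antisymmetry makes a least fixed point unique, so the description in
  \<open>least_fixpoint\<close> is well defined as soon as one exists.\<close>

lemma is_least_fixpoint_least_fixpoint:
  assumes "X \<in> Obj C" "Y \<in> Obj C" "\<exists>h. is_least_fixpoint (khom X Y) (kle X Y) F h"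
  shows "is_least_fixpoint (khom X Y) (kle X Y) F (least_fixpoint (khom X Y) (kle X Y) F)"
proof -
  obtain h where h: "is_least_fixpoint (khom X Y) (kle X Y) F h" using assms by blast
  have "k = h" if "is_least_fixpoint (khom X Y) (kle X Y) F k" for k
    using that h assms(1,2) K.le_antisym[of X Y k h] by (auto simp: is_least_fixpoint_def)
  with h show ?thesis unfolding least_fixpoint_def by (rule theI)
qed

text \<open>Both one-sided recursions are kept: the one in \<open>x \<cdot> r\<close> yields
  induction for multiplication on the right, the one in \<open>r \<cdot> x\<close> for
  multiplication on the left.\<close>

definition star_right :: "'o \<Rightarrow> 'a \<Rightarrow> 'a" where
  "star_right X r = least_fixpoint (khom X X) (kle X X) (\<lambda>x. J X X (kid X) (kcmp X X X x r))"

definition star_left :: "'o \<Rightarrow> 'a \<Rightarrow> 'a" where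
  "star_left X r = least_fixpoint (khom X X) (kle X X) (\<lambda>x. J X X (kid X) (kcmp X X X r x))"

text \<open>Taking the identity for \<open>q\<close> in \<open>lfp_right\<close> pulls
  \<open>p\<close> out of the fixed point, so the single star at \<open>X\<close> solves the
  equations for all targets \<open>Y\<close>.\<close>

lemma star_right_lfp:
  assumes "X \<in> Obj C" "Y \<in> Obj C" "p \<in> khom X Y" "r \<in> khom X X"
  shows "is_least_fixpoint (khom X Y) (kle X Y) (\<lambda>x. J X Y p (kcmp X X Y x r))
    (kcmp X X Y p (star_right X r))"
  using is_least_fixpoint_least_fixpoint[OF assms(1,2) ex_lfp_right[OF assms]]
    lfp_right[OF assms(1,1,2) kleisli_in(1)[OF assms(1)] assms(3,4)] assms
  by (simp add: star_right_def K.Idt_right)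

text \<open>Here the identity takes the place of \<open>p\<close> in \<open>lfp_left\<close>, so one
  star at \<open>Y\<close> serves all sources \<open>X\<close>.\<close>

lemma star_left_lfp:
  assumes "X \<in> Obj C" "Y \<in> Obj C" "p \<in> khom X Y" "r \<in> khom Y Y"
  shows "is_least_fixpoint (khom X Y) (kle X Y) (\<lambda>x. J X Y p (kcmp X Y Y r x))
    (kcmp X Y Y (star_left Y r) p)"
  using is_least_fixpoint_least_fixpoint[OF assms(1,2) ex_lfp_left[OF assms]]
    lfp_left[OF assms(1,2,2) assms(3) kleisli_in(1)[OF assms(2)] assms(4)] assms
  by (simp add: star_left_def K.Idt_left)

lemma star_right_in:
  assumes "X \<in> Obj C" "r \<in> khom X X"
  shows "star_right X r \<in> khom X X"
  using is_least_fixpoint_least_fixpoint[OF assms(1,1) ex_lfp_right[OF assms(1,1) _ assms(2)]]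
    assms kleisli_in(1)
  by (simp add: star_right_def is_least_fixpoint_def)

lemma star_left_in:
  assumes "X \<in> Obj C" "r \<in> khom X X"
  shows "star_left X r \<in> khom X X"
  using is_least_fixpoint_least_fixpoint[OF assms(1,1) ex_lfp_left[OF assms(1,1) _ assms(2)]]
    assms kleisli_in(1)
  by (simp add: star_left_def is_least_fixpoint_def)

lemma star_right_unfold:
  assumes "X \<in> Obj C" "r \<in> khom X X"
  shows "J X X (kid X) (kcmp X X X (star_right X r) r) = star_right X r"
  using star_right_lfp[OF assms(1,1) kleisli_in(1)[OF assms(1)] assms(2)] assms
  by (simp add: is_least_fixpoint_def K.Idt_left star_right_in)

lemma star_left_unfold:
  assumes "X \<in> Obj C" "r \<in> khom X X"
  shows "J X X (kid X) (kcmp X X X r (star_left X r)) = star_left X r"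
  using star_left_lfp[OF assms(1,1) kleisli_in(1)[OF assms(1)] assms(2)] assms
  by (simp add: is_least_fixpoint_def K.Idt_right star_left_in)

section \<open>Induction principles\<close>

lemma star_right_induct:
  assumes "X \<in> Obj C" "Y \<in> Obj C" "p \<in> khom X Y" "r \<in> khom X X" "g \<in> khom X Y"
    and "kle X Y p g" "kle X Y (kcmp X X Y g r) g"
  shows "kle X Y (kcmp X X Y p (star_right X r)) g"
proof -
  have s: "star_right X r \<in> khom X X" using assms by (simp add: star_right_in)
  \<comment> \<open>The closure hypothesis on \<open>g\<close> says that \<open>g\<close> is a fixed
    point of \<open>\<lambda>x. J X Y g (kcmp X X Y x r)\<close>, whose least fixed point is
    \<open>g\<close> composed with the star.\<close>
  have "J X Y g (kcmp X X Y g r) = g"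
    using assms J_commute[of X Y g "kcmp X X Y g r"] kleisli_in(2)[of X X Y r g]
    by (simp add: join_le_def)
  then have "kle X Y (kcmp X X Y g (star_right X r)) g"
    using star_right_lfp[of X Y g r] assms by (simp add: is_least_fixpoint_def)
  moreover have "kle X Y (kcmp X X Y p (star_right X r)) (kcmp X X Y g (star_right X r))"
    using assms s K.Cmp_mono[of X X Y] K.le_refl by simp
  ultimately show ?thesis
    using K.le_trans[of X Y "kcmp X X Y p (star_right X r)" "kcmp X X Y g (star_right X r)" g]
      kleisli_in(2)[OF assms(1,1,2) s] assms by simp
qed

lemma star_left_induct:
  assumes "X \<in> Obj C" "Y \<in> Obj C" "p \<in> khom X Y" "r \<in> khom Y Y" "g \<in> khom X Y"
    and "kle X Y p g" "kle X Y (kcmp X Y Y r g) g"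
  shows "kle X Y (kcmp X Y Y (star_left Y r) p) g"
proof -
  have s: "star_left Y r \<in> khom Y Y" using assms by (simp add: star_left_in)
  have "J X Y g (kcmp X Y Y r g) = g"
    using assms J_commute[of X Y g "kcmp X Y Y r g"] kleisli_in(2)[of X Y Y g r]
    by (simp add: join_le_def)
  then have "kle X Y (kcmp X Y Y (star_left Y r) g) g"
    using star_left_lfp[of X Y g r] assms by (simp add: is_least_fixpoint_def)
  moreover have "kle X Y (kcmp X Y Y (star_left Y r) p) (kcmp X Y Y (star_left Y r) g)"
    using assms s K.Cmp_mono[of X Y Y] K.le_refl by simp
  ultimately show ?thesis
    using K.le_trans[of X Y "kcmp X Y Y (star_left Y r) p" "kcmp X Y Y (star_left Y r) g" g]
      kleisli_in(2)[OF assms(1,2,2) _ s] assms by simp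
qed

section \<open>Closure properties and agreement of the two stars\<close>

lemma star_right_bounds:
  assumes X: "X \<in> Obj C" and r: "r \<in> khom X X"
  shows "kle X X (kid X) (star_right X r)"
    and "kle X X (kcmp X X X (star_right X r) r) (star_right X r)"
    and "kle X X r (star_right X r)"
proof -
  let ?s = "star_right X r"
  have s: "?s \<in> khom X X" and i: "kid X \<in> khom X X" and sr: "kcmp X X X ?s r \<in> khom X X"
    using assms star_right_in kleisli_in by blast+
  show 1: "kle X X (kid X) ?s" and 2: "kle X X (kcmp X X X ?s r) ?s"
    using join_upper[OF X X i sr] star_right_unfold[OF assms] by simp_all
  \<comment> \<open>\<open>r = 1 \<cdot> r \<le> ?s \<cdot> r \<le> ?s\<close>.\<close>
  have "kle X X (kcmp X X X (kid X) r) (kcmp X X X ?s r)"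
    using 1 X r s i K.Cmp_mono[of X X X] K.le_refl by simp
  then show "kle X X r ?s"
    using 2 K.le_trans[of X X r "kcmp X X X ?s r" ?s] X r s sr by (simp add: K.Idt_left)
qed

lemma star_left_bounds:
  assumes X: "X \<in> Obj C" and r: "r \<in> khom X X"
  shows "kle X X (kid X) (star_left X r)"
    and "kle X X (kcmp X X X r (star_left X r)) (star_left X r)"
    and "kle X X r (star_left X r)"
proof -
  let ?s = "star_left X r"
  have s: "?s \<in> khom X X" and i: "kid X \<in> khom X X" and rs: "kcmp X X X r ?s \<in> khom X X"
    using assms star_left_in kleisli_in by blast+
  show 1: "kle X X (kid X) ?s" and 2: "kle X X (kcmp X X X r ?s) ?s"
    using join_upper[OF X X i rs] star_left_unfold[OF assms] by simp_all
  have "kle X X (kcmp X X X r (kid X)) (kcmp X X X r ?s)"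
    using 1 X r s i K.Cmp_mono[of X X X] K.le_refl by simp
  then show "kle X X r ?s"
    using 2 K.le_trans[of X X r "kcmp X X X r ?s" ?s] X r s rs by (simp add: K.Idt_right)
qed

text \<open>Each star absorbs \<open>r\<close> on its other side too: for \<open>star_right\<close>
  this is right induction started at \<open>r\<close>, for \<open>star_left\<close> the mirror
  image. Hence each is a prefixed point of the other's recursion and lies above the other
  star.\<close>

lemma star_left_eq_star_right:
  assumes X: "X \<in> Obj C" and r: "r \<in> khom X X"
  shows "star_left X r = star_right X r"
proof -
  let ?l = "star_left X r" and ?s = "star_right X r"
  have l: "?l \<in> khom X X" and s: "?s \<in> khom X X" and i: "kid X \<in> khom X X"
    using assms star_left_in star_right_in kleisli_in by blast+
  have "kle X X (kcmp X X X r ?s) ?s"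
    using star_right_induct[OF X X r r s] star_right_bounds[OF assms] by simp
  then have "kle X X ?l ?s"
    using star_left_induct[OF X X i r s] star_right_bounds[OF assms] X l
    by (simp add: K.Idt_right)
  moreover have "kle X X (kcmp X X X ?l r) ?l"
    using star_left_induct[OF X X r r l] star_left_bounds[OF assms] by simp
  then have "kle X X ?s ?l"
    using star_right_induct[OF X X i r l] star_left_bounds[OF assms] X s
    by (simp add: K.Idt_left)
  ultimately show ?thesis using K.le_antisym[of X X ?l ?s] X l s by simp
qed

section \<open>Simulation inequalities\<close>

lemma star_simulation_le:
  assumes X: "X \<in> Obj C" and Y: "Y \<in> Obj C" and a: "a \<in> khom X X" and f: "f \<in> khom X Y"
    and b: "b \<in> khom Y Y" and le: "kle X Y (kcmp X X Y f a) (kcmp X Y Y b f)"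
  shows "kle X Y (kcmp X X Y f (star_right X a)) (kcmp X Y Y (star_right Y b) f)"
proof -
  let ?s = "star_right Y b"
  have s: "?s \<in> khom Y Y" and i: "kid Y \<in> khom Y Y" using Y b star_right_in kleisli_in by blast+
  have sf: "kcmp X Y Y ?s f \<in> khom X Y" and fa: "kcmp X X Y f a \<in> khom X Y"
    and bf: "kcmp X Y Y b f \<in> khom X Y" and sb: "kcmp Y Y Y ?s b \<in> khom Y Y"
    using X Y a b f s kleisli_in(2) by blast+
  have "kle X Y (kcmp X Y Y (kid Y) f) (kcmp X Y Y ?s f)"
    using star_right_bounds(1)[OF Y b] X Y f s i K.Cmp_mono[of X Y Y] K.le_refl by simp
  then have base: "kle X Y f (kcmp X Y Y ?s f)" using X Y f by (simp add: K.Idt_left)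
  \<comment> \<open>The chain \<open>?s \<cdot> f \<cdot> a \<le> ?s \<cdot> b \<cdot> f \<le> ?s
    \<cdot> f\<close> shows that \<open>?s \<cdot> f\<close> absorbs \<open>a\<close> on the right;
    together with \<open>base\<close> this is what right induction requires.\<close>
  have "kle X Y (kcmp X Y Y ?s (kcmp X X Y f a)) (kcmp X Y Y ?s (kcmp X Y Y b f))"
    using le X Y fa bf s K.Cmp_mono[of X Y Y] K.le_refl by simp
  moreover have "kle X Y (kcmp X Y Y (kcmp Y Y Y ?s b) f) (kcmp X Y Y ?s f)"
    using star_right_bounds(2)[OF Y b] X Y f s sb K.Cmp_mono[of X Y Y] K.le_refl by simp
  ultimately have "kle X Y (kcmp X X Y (kcmp X Y Y ?s f) a) (kcmp X Y Y ?s f)"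
    using K.Cmp_assoc[of X X Y Y a f ?s] K.Cmp_assoc[of X Y Y Y f b ?s]
      K.le_trans[of X Y "kcmp X Y Y ?s (kcmp X X Y f a)" "kcmp X Y Y ?s (kcmp X Y Y b f)"
        "kcmp X Y Y ?s f"] X Y a b f s fa bf sf kleisli_in(2)[of X Y Y] by simp
  then show ?thesis using star_right_induct[OF X Y f a sf base] by simp
qed

text \<open>Now \<open>b\<close> acts on the left of \<open>f\<close>, so left induction is used,
  based on \<open>b \<cdot> f \<cdot> ?s \<le> f \<cdot> a \<cdot> ?s \<le> f \<cdot> ?s\<close>
  with the left star of \<open>a\<close>. The agreement of the two stars turns the result into one
  about \<open>star_right\<close>.\<close>

lemma star_simulation_ge:
  assumes X: "X \<in> Obj C" and Y: "Y \<in> Obj C" and a: "a \<in> khom X X" and f: "f \<in> khom X Y"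
    and b: "b \<in> khom Y Y" and le: "kle X Y (kcmp X Y Y b f) (kcmp X X Y f a)"
  shows "kle X Y (kcmp X Y Y (star_right Y b) f) (kcmp X X Y f (star_right X a))"
proof -
  let ?s = "star_left X a"
  have s: "?s \<in> khom X X" and i: "kid X \<in> khom X X" using X a star_left_in kleisli_in by blast+
  have fs: "kcmp X X Y f ?s \<in> khom X Y" and fa: "kcmp X X Y f a \<in> khom X Y"
    and bf: "kcmp X Y Y b f \<in> khom X Y" and as: "kcmp X X X a ?s \<in> khom X X"
    using X Y a b f s kleisli_in(2) by blast+
  have "kle X Y (kcmp X X Y f (kid X)) (kcmp X X Y f ?s)"
    using star_left_bounds(1)[OF X a] X Y f s i K.Cmp_mono[of X X Y] K.le_refl by simp
  then have base: "kle X Y f (kcmp X X Y f ?s)" using X Y f by (simp add: K.Idt_right)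
  have "kle X Y (kcmp X X Y (kcmp X Y Y b f) ?s) (kcmp X X Y (kcmp X X Y f a) ?s)"
    using le X Y fa bf s K.Cmp_mono[of X X Y] K.le_refl by simp
  moreover have "kle X Y (kcmp X X Y f (kcmp X X X a ?s)) (kcmp X X Y f ?s)"
    using star_left_bounds(2)[OF X a] X Y f s as K.Cmp_mono[of X X Y] K.le_refl by simp
  ultimately have "kle X Y (kcmp X Y Y b (kcmp X X Y f ?s)) (kcmp X X Y f ?s)"
    using K.Cmp_assoc[of X X Y Y ?s f b] K.Cmp_assoc[of X X X Y ?s a f]
      K.le_trans[of X Y "kcmp X X Y (kcmp X Y Y b f) ?s" "kcmp X X Y (kcmp X X Y f a) ?s"
        "kcmp X X Y f ?s"] X Y a b f s fa bf fs as
      kleisli_in(2)[of X X Y] kleisli_in(2)[of X Y Y] by simp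
  then show ?thesis
    using star_left_induct[OF X Y f b fs base] star_left_eq_star_right X Y a b by simp
qed

section \<open>Saturation axioms\<close>

lemma star_right_trans:
  assumes X: "X \<in> Obj C" and r: "r \<in> khom X X"
  shows "kle X X (kcmp X X X (star_right X r) (star_right X r)) (star_right X r)"
proof -
  have s: "star_right X r \<in> khom X X" using assms by (rule star_right_in)
  \<comment> \<open>Right induction with the star both as starting morphism and as bound asks only
    for reflexivity and absorption of \<open>r\<close> on the right.\<close>
  show ?thesis
    using star_right_induct[OF X X s r s] star_right_bounds[OF assms] K.le_refl X s by simp
qed

text \<open>Transitivity makes \<open>b\<close> absorb \<open>r\<close>, since
  \<open>b \<cdot> r \<le> b \<cdot> b \<le> b\<close>; right induction then starts at the
  identity.\<close>

lemma star_right_least: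
  assumes X: "X \<in> Obj C" and r: "r \<in> khom X X" and b: "b \<in> khom X X"
    and le: "kle X X (kid X) b" "kle X X r b" "kle X X (kcmp X X X b b) b"
  shows "kle X X (star_right X r) b"
proof -
  have i: "kid X \<in> khom X X" and br: "kcmp X X X b r \<in> khom X X" and bb: "kcmp X X X b b \<in> khom X X"
    using X r b kleisli_in by blast+
  have "kle X X (kcmp X X X b r) (kcmp X X X b b)"
    using le X r b K.Cmp_mono[of X X X] K.le_refl by simp
  then have "kle X X (kcmp X X X b r) b"
    using le(3) K.le_trans[of X X "kcmp X X X b r" "kcmp X X X b b" b] X br bb b by simp
  then have "kle X X (kcmp X X X (kid X) (star_right X r)) b"
    using star_right_induct[OF X X i r b le(1)] by simp
  then show ?thesis using X r star_right_in by (simp add: K.Idt_left)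
qed

lemma sharp_in:
  assumes "X \<in> Obj C" "Y \<in> Obj C" "f \<in> Hom C X Y"
  shows "sharp C M X Y f \<in> khom X Y"
  using assms Cmp_in[of X Y "T_ob M Y"] F_ob_in unit_in by (simp add: sharp_def kleisli_def)

text \<open>The two conditions on \<open>sharp\<close> are instances of the simulation lemmas, which
  hold for arbitrary Kleisli morphisms; \<open>sharp_in\<close> supplies the membership.\<close>

lemma ordered_saturation_monad_star_right: "ordered_saturation_monad C M (join_le J) star_right"
  by unfold_locales
    (simp_all add: star_right_in star_right_bounds star_right_trans star_right_least
      star_simulation_le star_simulation_ge sharp_in)

end

theorem theorem5p4:
  fixes C :: "('o, 'a) cat" and M :: "('o, 'a) monad_data"
    and J :: "'o \<Rightarrow> 'o \<Rightarrow> 'a \<Rightarrow> 'a \<Rightarrow> 'a" and B :: "'o \<Rightarrow> 'o \<Rightarrow> 'a"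
  assumes "kleene_monad C M J B"
  shows "\<exists>star. ordered_saturation_monad C M (join_le J) star \<and>
    (\<forall>X \<in> Obj C. \<forall>Y \<in> Obj C.
      \<forall>\<alpha> \<in> Hom (kleisli C M) X X. \<forall>f \<in> Hom (kleisli C M) X Y. \<forall>\<beta> \<in> Hom (kleisli C M) Y Y.
        (join_le J X Y (Cmp (kleisli C M) X X Y f \<alpha>) (Cmp (kleisli C M) X Y Y \<beta> f) \<longrightarrow>
         join_le J X Y (Cmp (kleisli C M) X X Y f (star X \<alpha>))
                       (Cmp (kleisli C M) X Y Y (star Y \<beta>) f)) \<and>
        (join_le J X Y (Cmp (kleisli C M) X Y Y \<beta> f) (Cmp (kleisli C M) X X Y f \<alpha>) \<longrightarrow>
         join_le J X Y (Cmp (kleisli C M) X Y Y (star Y \<beta>) f)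
                       (Cmp (kleisli C M) X X Y f (star X \<alpha>))))"
proof -
  interpret kleene_monad C M J B by (rule assms)
  show ?thesis
    using ordered_saturation_monad_star_right star_simulation_le star_simulation_ge
    by (intro exI[of _ star_right]) simp
qed

end
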